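(* Consider the signature $\Sigma_U=\{0,-,\mathrm{app},+,\cdot\}$ where $0$ is a constant, $-$ is unary minus, $\mathrm{app}$ is a unary function symbol (unary append, written postfix as $x1$ in the paper, semantically $x+1$), and $+,\cdot$ are binary. Let $N_2$ be the term rewriting system over $\Sigma_U\setminus\{-\}$ given by the left-to-right oriented equations [U1] $x+0=x$; [U2$'$] $x+\mathrm{app}(y)=\mathrm{app}(x+y)$; [U3] $x\cdot 0=0$; [U4$'$] $x\cdot\mathrm{app}(y)=(x\cdot y)+x$, and let $Z_2$ be the term rewriting system over $\Sigma_U$ consisting of these four rules together with [U5] $-0=0$; [U6] $\mathrm{app}(-\mathrm{app}(x))=-x$; [U7] $-(-x)=x$; [U8] $x+(-y)=-((-x)+y)$; [U9] $x\cdot(-y)=-(x\cdot y)$. Then $N_2$ and $Z_2$ are ground-complete.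
   Context: Equations are read as rewrite rules from left to right with variables $x,y$. A term rewriting system is ground-complete if it is strongly terminating (no infinite rewrite sequences) and ground-confluent (confluent on closed terms). *)

theory Defs
  imports Main
begin

datatype ('f, vars_term: 'v) trm = Var 'v | Fun 'f "('f, 'v) trm list"

primrec subst :: "('v \<Rightarrow> ('f, 'w) trm) \<Rightarrow> ('f, 'v) trm \<Rightarrow> ('f, 'w) trm" where
  "subst \<sigma> (Var x) = \<sigma> x"
| "subst \<sigma> (Fun f ts) = Fun f (map (subst \<sigma>) ts)"

text \<open>A signature is a set of function symbols paired with their arities; the set
  \<open>terms_over F\<close> consists of the open terms that respect it.\<close>

inductive_set terms_over :: "('f \<times> nat) set \<Rightarrow> ('f, 'v) trm set"
  for F :: "('f \<times> nat) set" where
  Var: "Var x \<in> terms_over F"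
| Fun: "(f, length ts) \<in> F \<Longrightarrow> \<forall>t \<in> set ts. t \<in> terms_over F \<Longrightarrow> Fun f ts \<in> terms_over F"

definition closed_term :: "('f, 'v) trm \<Rightarrow> bool" where
  "closed_term t \<longleftrightarrow> vars_term t = {}"

inductive_set rewrite :: "(('f, 'v) trm \<times> ('f, 'v) trm) set \<Rightarrow> (('f, 'v) trm \<times> ('f, 'v) trm) set"
  for R :: "(('f, 'v) trm \<times> ('f, 'v) trm) set" where
  root: "(l, r) \<in> R \<Longrightarrow> (subst \<sigma> l, subst \<sigma> r) \<in> rewrite R"
| arg: "(s, t) \<in> rewrite R \<Longrightarrow> (Fun f (us @ s # vs), Fun f (us @ t # vs)) \<in> rewrite R"

definition rewrite_over ::
  "('f \<times> nat) set \<Rightarrow> (('f, 'v) trm \<times> ('f, 'v) trm) set \<Rightarrow> (('f, 'v) trm \<times> ('f, 'v) trm) set" where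
  "rewrite_over F R = rewrite R \<inter> terms_over F \<times> terms_over F"

definition strongly_terminating ::
  "('f \<times> nat) set \<Rightarrow> (('f, 'v) trm \<times> ('f, 'v) trm) set \<Rightarrow> bool" where
  "strongly_terminating F R \<longleftrightarrow>
     \<not> (\<exists>t :: nat \<Rightarrow> ('f, 'v) trm. \<forall>i. (t i, t (Suc i)) \<in> rewrite_over F R)"

definition ground_confluent ::
  "('f \<times> nat) set \<Rightarrow> (('f, 'v) trm \<times> ('f, 'v) trm) set \<Rightarrow> bool" where
  "ground_confluent F R \<longleftrightarrow>
     (\<forall>s t u. s \<in> terms_over F \<and> closed_term s \<and>
        (s, t) \<in> (rewrite_over F R)\<^sup>* \<and> (s, u) \<in> (rewrite_over F R)\<^sup>* \<longrightarrow>
        (\<exists>v. (t, v) \<in> (rewrite_over F R)\<^sup>* \<and> (u, v) \<in> (rewrite_over F R)\<^sup>*))"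

definition ground_complete ::
  "('f \<times> nat) set \<Rightarrow> (('f, 'v) trm \<times> ('f, 'v) trm) set \<Rightarrow> bool" where
  "ground_complete F R \<longleftrightarrow> strongly_terminating F R \<and> ground_confluent F R"

datatype fsym = Zero | Minus | App | Add | Mul

definition sig_U :: "(fsym \<times> nat) set" where
  "sig_U = {(Zero, 0), (Minus, 1), (App, 1), (Add, 2), (Mul, 2)}"

abbreviation zero_term :: "(fsym, 'v) trm" ("\<zero>") where
  "\<zero> \<equiv> Fun Zero []"

abbreviation neg :: "(fsym, 'v) trm \<Rightarrow> (fsym, 'v) trm" where
  "neg s \<equiv> Fun Minus [s]"

abbreviation app :: "(fsym, 'v) trm \<Rightarrow> (fsym, 'v) trm" where
  "app s \<equiv> Fun App [s]"

abbreviation add :: "(fsym, 'v) trm \<Rightarrow> (fsym, 'v) trm \<Rightarrow> (fsym, 'v) trm" (infixl "\<oplus>" 65) where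
  "s \<oplus> t \<equiv> Fun Add [s, t]"

abbreviation mul :: "(fsym, 'v) trm \<Rightarrow> (fsym, 'v) trm \<Rightarrow> (fsym, 'v) trm" (infixl "\<odot>" 70) where
  "s \<odot> t \<equiv> Fun Mul [s, t]"

text \<open>Terms are built over the countably infinite supply of variables \<open>Var n\<close>,
  two of which serve as the variables of the rules.\<close>

abbreviation vx :: "(fsym, nat) trm" where "vx \<equiv> Var 0"
abbreviation vy :: "(fsym, nat) trm" where "vy \<equiv> Var 1"

definition sig_N2 :: "(fsym \<times> nat) set" where
  "sig_N2 = sig_U - {(Minus, 1)}"

definition rules_N2 :: "((fsym, nat) trm \<times> (fsym, nat) trm) set" where
  "rules_N2 =
    {(vx \<oplus> \<zero>, vx),
     (vx \<oplus> app vy, app (vx \<oplus> vy)),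
     (vx \<odot> \<zero>, \<zero>),
     (vx \<odot> app vy, (vx \<odot> vy) \<oplus> vx)}"

definition rules_Z2 :: "((fsym, nat) trm \<times> (fsym, nat) trm) set" where
  "rules_Z2 = rules_N2 \<union>
    {(neg \<zero>, \<zero>),
     (app (neg (app vx)), neg vx),
     (neg (neg vx), vx),
     (vx \<oplus> neg vy, neg (neg vx \<oplus> vy)),
     (vx \<odot> neg vy, neg (vx \<odot> vy))}"

end

theory Submission
  imports Defs
begin

text \<open>Termination follows from a strictly monotone interpretation in the natural numbers.
  For ground confluence, the rules are valid in the integers, and the closed normal forms are the
  numerals \<open>app\<^sup>n(0)\<close>, together with \<open>-app\<^sup>n\<^sup>+\<^sup>1(0)\<close> in the presence of negation; these have
  pairwise different integer values. So any two normal forms of a closed term coincide.\<close>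

section \<open>Terms and rewriting\<close>

primrec eval :: "('f \<Rightarrow> 'a list \<Rightarrow> 'a) \<Rightarrow> ('v \<Rightarrow> 'a) \<Rightarrow> ('f, 'v) trm \<Rightarrow> 'a" where
  "eval I \<alpha> (Var x) = \<alpha> x"
| "eval I \<alpha> (Fun f ts) = I f (map (eval I \<alpha>) ts)"

text \<open>A substitution is absorbed into the assignment. An equation or inequality checked for a
  rule under all assignments therefore holds for all its instances.\<close>

lemma eval_subst: "eval I \<alpha> (subst \<sigma> t) = eval I (\<lambda>x. eval I \<alpha> (\<sigma> x)) t"
  by (induction t) (auto intro!: arg_cong[where f = "I _"])

lemma rewrite_eval_eq:
  assumes "(s, t) \<in> rewrite R"
    and "\<And>l r \<alpha>. (l, r) \<in> R \<Longrightarrow> eval I \<alpha> l = eval I \<alpha> r"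
  shows "eval I \<alpha> s = eval I \<alpha> t"
  using assms(1) by induction (simp_all add: eval_subst assms(2))

lemma rewrite_eval_less:
  fixes I :: "'f \<Rightarrow> 'a::order list \<Rightarrow> 'a"
  assumes "(s, t) \<in> rewrite R"
    and "\<And>l r \<alpha>. (l, r) \<in> R \<Longrightarrow> eval I \<alpha> r < eval I \<alpha> l"
    and "\<And>f a b us vs. a < b \<Longrightarrow> I f (us @ a # vs) < I f (us @ b # vs)"
  shows "eval I \<alpha> t < eval I \<alpha> s"
  using assms(1) by induction (simp_all add: eval_subst assms(2,3))

lemma Fun_in_terms_over_iff:
  "Fun f ts \<in> terms_over F \<longleftrightarrow> (f, length ts) \<in> F \<and> set ts \<subseteq> terms_over F"
  by (auto intro: terms_over.Fun elim: terms_over.cases)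

lemma subst_in_terms_over:
  assumes "t \<in> terms_over F" and "\<And>x. x \<in> vars_term t \<Longrightarrow> \<sigma> x \<in> terms_over F"
  shows "subst \<sigma> t \<in> terms_over F"
  using assms by (induction t) (auto simp: Fun_in_terms_over_iff)

lemma terms_over_substD:
  assumes "subst \<sigma> t \<in> terms_over F" and "x \<in> vars_term t"
  shows "\<sigma> x \<in> terms_over F"
  using assms by (induction t) (auto simp: Fun_in_terms_over_iff)

lemma vars_term_subst: "vars_term (subst \<sigma> t) = (\<Union>x \<in> vars_term t. vars_term (\<sigma> x))"
  by (induction t) auto

lemma closed_Fun_iff: "closed_term (Fun f ts) \<longleftrightarrow> (\<forall>t \<in> set ts. closed_term t)"
  by (auto simp: closed_term_def)

lemma rewrite_vars_term_subset:
  assumes "(s, t) \<in> rewrite R" and "\<And>l r. (l, r) \<in> R \<Longrightarrow> vars_term r \<subseteq> vars_term l"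
  shows "vars_term t \<subseteq> vars_term s"
  using assms(1)
proof induction
  case (root l r \<sigma>)
  then show ?case using assms(2)[of l r] by (auto simp: vars_term_subst)
qed auto

text \<open>In a root step every variable of \<open>r\<close> occurs in \<open>l\<close>, so its
  image is a subterm of the given instance of \<open>l\<close> and hence lies over
  \<open>F\<close>.\<close>

lemma rewrite_in_terms_over:
  assumes "(s, t) \<in> rewrite R" and "s \<in> terms_over F"
    and "\<And>l r. (l, r) \<in> R \<Longrightarrow> vars_term r \<subseteq> vars_term l \<and> r \<in> terms_over F"
  shows "t \<in> terms_over F"
  using assms(1,2)
proof induction
  case (root l r \<sigma>)
  then show ?case
    using assms(3)[of l r] by (blast intro: subst_in_terms_over dest: terms_over_substD)
qed (auto simp: Fun_in_terms_over_iff)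

section \<open>Normal forms and a criterion for ground completeness\<close>

definition normal :: "(('f, 'v) trm \<times> ('f, 'v) trm) set \<Rightarrow> ('f, 'v) trm \<Rightarrow> bool" where
  "normal R t \<longleftrightarrow> (\<forall>u. (t, u) \<notin> rewrite R)"

lemma normal_arg:
  assumes "normal R (Fun f ts)" and "t \<in> set ts"
  shows "normal R t"
proof -
  obtain us vs where "ts = us @ t # vs"
    using assms(2) by (meson split_list)
  then show ?thesis
    using assms(1) by (auto simp: normal_def intro: rewrite.arg)
qed

lemma not_normal_root: "(l, r) \<in> R \<Longrightarrow> \<not> normal R (subst \<sigma> l)"
  by (auto simp: normal_def intro: rewrite.root)

text \<open>No critical pairs are examined. The measure \<open>m\<close> yields both termination and
  the existence of normal forms. Since \<open>v\<close> is invariant under rewriting, all normal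
  forms of a closed term have its value, and \<open>uniq\<close> identifies them.\<close>

lemma ground_completeI:
  fixes m :: "('f, 'v) trm \<Rightarrow> nat"
  assumes less: "\<And>s t. (s, t) \<in> rewrite R \<Longrightarrow> m t < m s"
    and rule: "\<And>l r. (l, r) \<in> R \<Longrightarrow> vars_term r \<subseteq> vars_term l \<and> r \<in> terms_over F"
    and val: "\<And>s t. (s, t) \<in> rewrite R \<Longrightarrow> v s = v t"
    and uniq: "\<And>t u. \<lbrakk>t \<in> terms_over F; closed_term t; normal R t;
        u \<in> terms_over F; closed_term u; normal R u; v t = v u\<rbrakk> \<Longrightarrow> t = u"
  shows "ground_complete F R"
proof -
  have "strongly_terminating F R"
    unfolding strongly_terminating_def
  proof
    assume "\<exists>t. \<forall>i. (t i, t (Suc i)) \<in> rewrite_over F R"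
    then obtain t where "\<forall>i. (t i, t (Suc i)) \<in> rewrite R"
      unfolding rewrite_over_def by blast
    then have "\<forall>i. (t (Suc i), t i) \<in> measure m"
      by (simp add: less)
    then show False
      using wf_iff_no_infinite_down_chain[of "measure m"] by auto
  qed
  moreover have "ground_confluent F R"
  proof -
    have closed: "closed_term t" if "(s, t) \<in> rewrite R" "closed_term s" for s t
      using rewrite_vars_term_subset[OF that(1)] rule that(2) by (auto simp: closed_term_def)
    have nf: "\<exists>u. (t, u) \<in> (rewrite_over F R)\<^sup>* \<and> normal R u" if "t \<in> terms_over F" for t
      using that
    proof (induction "m t" arbitrary: t rule: less_induct)
      case less
      show ?case
      proof (cases "normal R t")
        case False
        then obtain t' where t': "(t, t') \<in> rewrite R"
          by (auto simp: normal_def)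
        \<comment> \<open>\<open>normal\<close> refers to \<open>rewrite R\<close> on all terms, so
          the step has to be shown to stay over \<open>F\<close>; \<open>rule\<close> ensures
          this.\<close>
        then have "(t, t') \<in> rewrite_over F R"
          using less.prems rewrite_in_terms_over[OF t' less.prems rule]
          by (simp add: rewrite_over_def)
        moreover obtain u where "(t', u) \<in> (rewrite_over F R)\<^sup>*" "normal R u"
          using less.hyps[OF assms(1)[OF t']] calculation by (auto simp: rewrite_over_def)
        ultimately show ?thesis
          by (blast intro: converse_rtrancl_into_rtrancl)
      qed blast
    qed
    have steps: "t \<in> terms_over F \<and> closed_term t \<and> v t = v s"
      if "(s, t) \<in> (rewrite_over F R)\<^sup>*" "s \<in> terms_over F" "closed_term s" for s t
      using that
      by (induction rule: rtrancl_induct) (auto simp: rewrite_over_def dest: closed val)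
    show ?thesis
      unfolding ground_confluent_def
    proof (intro allI impI)
      fix s t u
      assume *: "s \<in> terms_over F \<and> closed_term s \<and>
        (s, t) \<in> (rewrite_over F R)\<^sup>* \<and> (s, u) \<in> (rewrite_over F R)\<^sup>*"
      then obtain t' u' where
        t': "(t, t') \<in> (rewrite_over F R)\<^sup>*" "normal R t'" and
        u': "(u, u') \<in> (rewrite_over F R)\<^sup>*" "normal R u'"
        using nf steps by meson
      have "t' \<in> terms_over F \<and> closed_term t' \<and> v t' = v s"
        "u' \<in> terms_over F \<and> closed_term u' \<and> v u' = v s"
        using * t'(1) u'(1) by (meson steps rtrancl_trans)+
      then have "t' = u'"
        using t'(2) u'(2) by (intro uniq) auto
      then show "\<exists>w. (t, w) \<in> (rewrite_over F R)\<^sup>* \<and> (u, w) \<in> (rewrite_over F R)\<^sup>*"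
        using t'(1) u'(1) by blast
    qed
  qed
  ultimately show ?thesis
    by (simp add: ground_complete_def)
qed

section \<open>The two interpretations\<close>

text \<open>The factor 3 in the second argument of a sum pays for the additional negation in [U8].
  Ill-formed applications get a strictly monotone default value.\<close>

fun weight_fun :: "fsym \<Rightarrow> nat list \<Rightarrow> nat" where
  "weight_fun Add [x, y] = x + 3 * y + 1"
| "weight_fun Mul [x, y] = 4 * Suc x * Suc y"
| "weight_fun Zero [] = 0"
| "weight_fun f xs = Suc (sum_list xs)"

lemma weight_fun_default:
  assumes "xs \<noteq> []" "length xs \<noteq> 2"
  shows "weight_fun f xs = Suc (sum_list xs)"
  using assms by (cases "(f, xs)" rule: weight_fun.cases) simp_all

lemma weight_fun_strict_mono:
  assumes "a < b"
  shows "weight_fun f (us @ a # vs) < weight_fun f (us @ b # vs)"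
proof -
  \<comment> \<open>Only binary applications are non-additive, and there the changed argument is the
    first or the second. All other lengths, including the well-formed unary ones, use the default
    sum.\<close>
  consider x where "us = []" "vs = [x]" | x where "us = [x]" "vs = []"
    | "length us + length vs \<noteq> 1"
    by (auto simp: add_is_1 length_Suc_conv)
  then show ?thesis
  proof cases
    case 1
    then show ?thesis
      using assms by (cases f) (simp_all add: add_less_le_mono)
  next
    case 2
    then show ?thesis
      using assms by (cases f) simp_all
  next
    case 3
    then show ?thesis
      using assms by (simp add: weight_fun_default)
  qed
qed

text \<open>In [U4'] the left side exceeds the weight of the product on the right by 4(x+1), while
  the new sum costs only 3x+1; this is the purpose of the factor 4. In [U8] the margin is exactly
  1.\<close>

lemma rules_Z2_weight_less:
  "(l, r) \<in> rules_Z2 \<Longrightarrow> eval weight_fun \<alpha> r < eval weight_fun \<alpha> l"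
  by (auto simp: rules_Z2_def rules_N2_def)

text \<open>The last equation serves both as the meaning of \<open>Zero\<close> and as the value of
  ill-formed applications.\<close>

fun value_fun :: "fsym \<Rightarrow> int list \<Rightarrow> int" where
  "value_fun Minus [x] = - x"
| "value_fun App [x] = x + 1"
| "value_fun Add [x, y] = x + y"
| "value_fun Mul [x, y] = x * y"
| "value_fun _ _ = 0"

lemma rules_Z2_value_eq:
  "(l, r) \<in> rules_Z2 \<Longrightarrow> eval value_fun \<alpha> l = eval value_fun \<alpha> r"
  by (auto simp: rules_Z2_def rules_N2_def algebra_simps)

section \<open>Closed normal forms\<close>

primrec numeral_term :: "nat \<Rightarrow> (fsym, 'v) trm" where
  "numeral_term 0 = \<zero>"
| "numeral_term (Suc n) = app (numeral_term n)"

lemma eval_numeral_term [simp]: "eval value_fun \<alpha> (numeral_term n) = int n"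
  by (induction n) auto

text \<open>Stated for every \<open>R\<close> containing \<open>rules_N2\<close> so that it serves
  both systems.\<close>

lemma not_normal_N2:
  assumes "rules_N2 \<subseteq> R"
  shows "\<not> normal R (s \<oplus> \<zero>)" "\<not> normal R (s \<oplus> app t)"
    "\<not> normal R (s \<odot> \<zero>)" "\<not> normal R (s \<odot> app t)"
  using assms not_normal_root[where \<sigma> = "\<lambda>n. if n = 0 then s else t" and R = R]
  by (fastforce simp: rules_N2_def)+

lemma not_normal_Z2:
  shows "\<not> normal rules_Z2 (neg \<zero>)" "\<not> normal rules_Z2 (app (neg (app s)))"
    "\<not> normal rules_Z2 (neg (neg s))" "\<not> normal rules_Z2 (s \<oplus> neg t)"
    "\<not> normal rules_Z2 (s \<odot> neg t)"
  using not_normal_root[where \<sigma> = "\<lambda>n. if n = 0 then s else t" and R = rules_Z2]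
  by (fastforce simp: rules_Z2_def)+

text \<open>By induction the second argument of a sum or product is a numeral, so it is
  \<open>\<zero>\<close> or starts with \<open>App\<close>; in both cases a rule applies at the
  root.\<close>

lemma normal_N2_numeral:
  assumes "t \<in> terms_over sig_N2" "closed_term t" "normal rules_N2 t"
  shows "\<exists>n. t = numeral_term n"
  using assms
proof induction
  case (Fun f ts)
  have args: "\<exists>n. t = numeral_term n" if "t \<in> set ts" for t
    using Fun that normal_arg[of rules_N2 f ts t] by (auto simp: closed_Fun_iff)
  note [simp] = not_normal_N2[OF order_refl]
  consider "f = Zero" "ts = []" | s where "f = App" "ts = [s]"
    | s u where "f = Add \<or> f = Mul" "ts = [s, u]"
    using Fun.hyps by (auto simp: sig_N2_def sig_U_def length_Suc_conv numeral_2_eq_2)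
  then show ?case
  proof cases
    case 1
    then have "Fun f ts = numeral_term 0"
      by simp
    then show ?thesis
      by blast
  next
    case (2 s)
    then obtain n where "s = numeral_term n"
      using args by auto
    then have "Fun f ts = numeral_term (Suc n)"
      using 2 by simp
    then show ?thesis
      by blast
  next
    case (3 s u)
    then obtain n where "u = numeral_term n"
      using args by auto
    then show ?thesis
      using Fun.prems(2) 3 by (cases n) auto
  qed
qed (simp add: closed_term_def)

lemma normal_Z2_numeral:
  assumes "t \<in> terms_over sig_U" "closed_term t" "normal rules_Z2 t"
  shows "\<exists>n. t = numeral_term n \<or> t = neg (numeral_term (Suc n))"
  using assms
proof induction
  case (Fun f ts)
  have args: "\<exists>n. t = numeral_term n \<or> t = neg (numeral_term (Suc n))" if "t \<in> set ts" for t
    using Fun that normal_arg[of rules_Z2 f ts t] by (auto simp: closed_Fun_iff)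
  have "rules_N2 \<subseteq> rules_Z2"
    by (auto simp: rules_Z2_def)
  note [simp] = not_normal_N2[OF this] not_normal_Z2
  consider "f = Zero" "ts = []" | s where "f = App" "ts = [s]" | s where "f = Minus" "ts = [s]"
    | s u where "f = Add \<or> f = Mul" "ts = [s, u]"
    using Fun.hyps by (auto simp: sig_U_def length_Suc_conv numeral_2_eq_2)
  then show ?case
  proof cases
    case 1
    then have "Fun f ts = numeral_term 0"
      by simp
    then show ?thesis
      by blast
  next
    case (2 s)
    then obtain n where "s = numeral_term n \<or> s = neg (numeral_term (Suc n))"
      using args by auto
    then have "Fun f ts = numeral_term (Suc n)"
      using Fun.prems(2) 2 by auto
    \<comment> \<open>The argument was not a negated numeral: that would be
      \<open>neg (app _)\<close>, and [U6] would apply.\<close>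
    then show ?thesis
      by blast
  next
    case (3 s)
    then obtain n where "s = numeral_term n \<or> s = neg (numeral_term (Suc n))"
      using args by auto
    then show ?thesis
      \<comment> \<open>[U5] excludes \<open>n = 0\<close> and [U7] excludes a negated argument,
        which leaves the negation of a positive numeral.\<close>
      using Fun.prems(2) 3 by (cases n) auto
  next
    case (4 s u)
    then obtain n where "u = numeral_term n \<or> u = neg (numeral_term (Suc n))"
      using args by auto
    then show ?thesis
      using Fun.prems(2) 4 by (cases n) auto
  qed
qed (simp add: closed_term_def)

lemma rules_N2_wf:
  "(l, r) \<in> rules_N2 \<Longrightarrow> vars_term r \<subseteq> vars_term l \<and> r \<in> terms_over sig_N2"
  by (auto simp: rules_N2_def sig_N2_def sig_U_def Fun_in_terms_over_iff terms_over.Var)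

lemma rules_Z2_wf:
  "(l, r) \<in> rules_Z2 \<Longrightarrow> vars_term r \<subseteq> vars_term l \<and> r \<in> terms_over sig_U"
  by (auto simp: rules_Z2_def rules_N2_def sig_U_def Fun_in_terms_over_iff terms_over.Var)

theorem theorem3p2p1:
  shows "ground_complete sig_N2 rules_N2 \<and> ground_complete sig_U rules_Z2"
proof -
  let ?m = "eval weight_fun (\<lambda>_. 0) :: (fsym, nat) trm \<Rightarrow> nat"
  let ?v = "eval value_fun (\<lambda>_. 0) :: (fsym, nat) trm \<Rightarrow> int"
  have sub: "rules_N2 \<subseteq> rules_Z2"
    by (auto simp: rules_Z2_def)
  \<comment> \<open>Allowing any subset of \<open>rules_Z2\<close> lets the smaller system inherit
    both interpretations.\<close>
  have less: "?m t < ?m s" if "(s, t) \<in> rewrite R" "R \<subseteq> rules_Z2" for R s t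
    using that rules_Z2_weight_less weight_fun_strict_mono
    by (intro rewrite_eval_less[of s t R]) blast+
  have val: "?v s = ?v t" if "(s, t) \<in> rewrite R" "R \<subseteq> rules_Z2" for R s t
    using that rules_Z2_value_eq by (intro rewrite_eval_eq[of s t R]) blast+
  have "ground_complete sig_N2 rules_N2"
  proof (rule ground_completeI[where m = ?m and v = ?v])
    fix t u :: "(fsym, nat) trm"
    assume "t \<in> terms_over sig_N2" "closed_term t" "normal rules_N2 t"
      "u \<in> terms_over sig_N2" "closed_term u" "normal rules_N2 u" "?v t = ?v u"
    then show "t = u"
      using normal_N2_numeral[of t] normal_N2_numeral[of u] by auto
  qed (use less val sub rules_N2_wf in blast)+
  moreover have "ground_complete sig_U rules_Z2"
  proof (rule ground_completeI[where m = ?m and v = ?v])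
    fix t u :: "(fsym, nat) trm"
    assume "t \<in> terms_over sig_U" "closed_term t" "normal rules_Z2 t"
      "u \<in> terms_over sig_U" "closed_term u" "normal rules_Z2 u" "?v t = ?v u"
    then show "t = u"
      \<comment> \<open>The values are n for numerals and -(n+1) for negated ones, so the value
        determines the sign and n. Keeping \<open>numeral_term (Suc n)\<close> folded lets
        \<open>eval_numeral_term\<close> apply to it.\<close>
      using normal_Z2_numeral[of t] normal_Z2_numeral[of u]
      by (auto simp del: numeral_term.simps)
  qed (use less val rules_Z2_wf in blast)+
  ultimately show ?thesis ..
qed

end
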